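(* The graphs $G_3$ and $G_4$ are Ramanujan graphs: for each of them, every eigenvalue $\lambda$ of the adjacency matrix with $\lambda\neq\pm 6$ satisfies $|\lambda|\le 2\sqrt{5}$.
   Context: Let $P$ be the Petersen graph on vertex set $\{0,1,\dots,9\}$ whose 15 edges are the unordered pairs underlying the following set of directed edges (an orientation $\vec P$ of $P$): $E(\vec P)=\{(0,1),(0,4),(0,5),(1,2),(1,6),(2,3),(2,7),(3,4),(3,8),(4,9),(5,7),(5,8),(6,8),(6,9),(7,9)\}$. For $n\ge 3$ let $\sigma$ be the cyclic permutation of $\{1,\dots,n\}$ given by $\sigma(i)=i+1$ for $i<n$ and $\sigma(n)=1$. The graph $G_n$ is the simple undirected graph with vertex set $\{(i,x):1\le i\le n,\ 0\le x\le 9\}$ in which $(i,x)\sim(i,y)$ whenever $\{x,y\}$ is an edge of $P$, and $(i,x)\sim(\sigma(i),y)$ whenever $(x,y)\in E(\vec P)$. A $d$-regular graph is Ramanujan if every adjacency eigenvalue $\lambda\ne\pm d$ satisfies $|\lambda|\le 2\sqrt{d-1}$; here $d=6$. *)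

theory Defs
  imports "Graph_Theory.Pair_Digraph" "Jordan_Normal_Form.Char_Poly" Complex_Main
begin

definition petersen_arcs :: "nat rel" where
  "petersen_arcs =
     {(0,1), (0,4), (0,5), (1,2), (1,6), (2,3), (2,7), (3,4), (3,8), (4,9),
      (5,7), (5,8), (6,8), (6,9), (7,9)}"

definition petersen_graph :: "nat pair_pre_digraph" where
  "petersen_graph = \<lparr> pverts = {0..9}, parcs = petersen_arcs \<union> petersen_arcs\<inverse> \<rparr>"

definition cyc :: "nat \<Rightarrow> nat \<Rightarrow> nat" where
  "cyc n i = (if i < n then i + 1 else 1)"

text \<open>As in \<^locale>\<open>pair_graph\<close>, an undirected edge is represented by its two arcs; this is
  why the arcs between layers are symmetrised.\<close>

definition layer_arcs :: "nat \<Rightarrow> (nat \<times> nat) rel" where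
  "layer_arcs n = {((i, x), (i, y)) | i x y. i \<in> {1..n} \<and> (x, y) \<in> parcs petersen_graph}"

definition cross_arcs :: "nat \<Rightarrow> (nat \<times> nat) rel" where
  "cross_arcs n = {((i, x), (cyc n i, y)) | i x y. i \<in> {1..n} \<and> (x, y) \<in> petersen_arcs}"

definition graph_G :: "nat \<Rightarrow> (nat \<times> nat) pair_pre_digraph" where
  "graph_G n = \<lparr> pverts = {1..n} \<times> {0..9},
           parcs = layer_arcs n \<union> cross_arcs n \<union> (cross_arcs n)\<inverse> \<rparr>"

definition adjacency_matrix :: "'a pair_pre_digraph \<Rightarrow> 'a list \<Rightarrow> complex mat" where
  "adjacency_matrix H vs =
     mat (length vs) (length vs) (\<lambda>(i, j). if (vs ! i, vs ! j) \<in> parcs H then 1 else 0)"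

text \<open>Matrices are indexed by natural numbers, so the vertices have to be enumerated. Another
  enumeration conjugates the matrix by a permutation and gives the same eigenvalues.\<close>

definition adjacency_eigenvalue :: "'a pair_pre_digraph \<Rightarrow> complex \<Rightarrow> bool" where
  "adjacency_eigenvalue H \<mu> \<longleftrightarrow>
     (\<exists>vs. distinct vs \<and> set vs = pverts H \<and> eigenvalue (adjacency_matrix H vs) \<mu>)"

definition regular_graph :: "nat \<Rightarrow> 'a pair_pre_digraph \<Rightarrow> bool" where
  "regular_graph d H \<longleftrightarrow>
     pair_graph H \<and> (\<forall>v \<in> pverts H. out_degree (with_proj H) v = d)"

definition ramanujan_graph :: "nat \<Rightarrow> 'a pair_pre_digraph \<Rightarrow> bool" where
  "ramanujan_graph d H \<longleftrightarrow>
     regular_graph d H \<and>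
     (\<forall>\<mu>. adjacency_eigenvalue H \<mu> \<and> \<mu> \<noteq> of_nat d \<and> \<mu> \<noteq> - of_nat d
        \<longrightarrow> cmod \<mu> \<le> 2 * sqrt (real d - 1))"

end

theory Submission
  imports Defs
begin

text \<open>Rotating the layers is an automorphism of the graph, so a discrete Fourier transform in the
  layer index splits the adjacency operator into operators on functions on the Petersen graph, one
  for every \<open>n\<close>-th root of unity \<open>w\<close>: the weighted adjacency operators with weight
  \<open>1 + 1 / w\<close> along the orientation and \<open>1 + w\<close> against it. For \<open>w = 1\<close> this is
  twice the adjacency operator of the Petersen graph, with eigenvalues \<open>6, 2, - 4\<close>. For
  \<open>w \<noteq> 1\<close> every row has three entries of modulus \<open>cmod (1 + w)\<close>, so the eigenvalues are
  bounded by \<open>3 * cmod (1 + w)\<close>, which is at most \<open>3 * sqrt 2 < 2 * sqrt 5\<close> if \<open>n\<close> is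
  3 or 4.\<close>

section \<open>Eigenvectors as functions on the vertices\<close>

text \<open>Removes the enumeration: an eigenvector is indexed by positions in \<open>vs\<close>,
  and composing it with the inverse of \<open>nth vs\<close> makes it a function on vertices, so
  later arguments see only the graph.\<close>

lemma adjacency_eigenvalueE:
  assumes "adjacency_eigenvalue H \<mu>"
  obtains f where "\<exists>u \<in> pverts H. f u \<noteq> 0"
    and "\<And>u. u \<in> pverts H \<Longrightarrow> \<mu> * f u = (\<Sum>v \<in> {v \<in> pverts H. (u, v) \<in> parcs H}. f v)"
proof -
  obtain vs where vs: "distinct vs" "set vs = pverts H"
    and "eigenvalue (adjacency_matrix H vs) \<mu>"
    using assms unfolding adjacency_eigenvalue_def by blast
  then obtain v where ev: "eigenvector (adjacency_matrix H vs) v \<mu>"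
    unfolding eigenvalue_def by blast
  let ?m = "length vs" and ?A = "adjacency_matrix H vs"
  have v: "v \<in> carrier_vec ?m" "v \<noteq> 0\<^sub>v ?m" "?A *\<^sub>v v = \<mu> \<cdot>\<^sub>v v"
    using ev unfolding eigenvector_def adjacency_matrix_def by simp_all
  have bij: "bij_betw (nth vs) {..<?m} (pverts H)"
    using vs by (simp add: bij_betw_nth)
  define f where "f u = v $ (inv_into {..<?m} (nth vs) u)" for u
  have f_nth: "f (vs ! i) = v $ i" if "i < ?m" for i
    using that bij by (simp add: f_def bij_betw_def inv_into_f_f)
  have nonzero: "\<exists>u \<in> pverts H. f u \<noteq> 0"
  proof -
    obtain i where "i < ?m" "v $ i \<noteq> 0"
      using v(1,2) by (metis carrier_vecD eq_vecI index_zero_vec)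
    then show ?thesis
      using f_nth vs(2) by (metis nth_mem)
  qed
  have "\<mu> * f u = (\<Sum>v \<in> {v \<in> pverts H. (u, v) \<in> parcs H}. f v)"
    if u: "u \<in> pverts H" for u
  proof -
    obtain i where i: "i < ?m" "u = vs ! i"
      using u vs(2) by (metis in_set_conv_nth)
    have "\<mu> * f u = (?A *\<^sub>v v) $ i"
      using i v(1) f_nth by (simp add: v(3))
    also have "\<dots> = (\<Sum>j<?m. (if (u, vs ! j) \<in> parcs H then 1 else 0) * f (vs ! j))"
      using i v(1) f_nth
      by (auto simp: adjacency_matrix_def scalar_prod_def lessThan_atLeast0 intro!: sum.cong)
    also have "\<dots> = (\<Sum>v \<in> pverts H. (if (u, v) \<in> parcs H then 1 else 0) * f v)"
      by (rule sum.reindex_bij_betw[OF bij])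
    also have "\<dots> = (\<Sum>v \<in> {v \<in> pverts H. (u, v) \<in> parcs H}. f v)"
      using vs(2)[symmetric] by (simp add: sum.inter_filter if_distrib[of "\<lambda>c. c * _"] cong: if_cong)
    finally show ?thesis .
  qed
  with nonzero show thesis
    by (rule that)
qed

section \<open>Oriented neighbourhoods in the Petersen graph\<close>

text \<open>Neighbourhoods are split by orientation because a cross arc moves one layer forward
  along an oriented edge and one layer back against it.\<close>

definition petersen_out :: "nat \<Rightarrow> nat set" where
  "petersen_out x = {y. (x, y) \<in> petersen_arcs}"

definition petersen_in :: "nat \<Rightarrow> nat set" where
  "petersen_in x = {y. (y, x) \<in> petersen_arcs}"

lemma petersen_out_simps:
  "petersen_out 0 = {1, 4, 5}" "petersen_out 1 = {2, 6}" "petersen_out 2 = {3, 7}"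
  "petersen_out 3 = {4, 8}" "petersen_out 4 = {9}" "petersen_out 5 = {7, 8}"
  "petersen_out 6 = {8, 9}" "petersen_out 7 = {9}" "petersen_out 8 = {}" "petersen_out 9 = {}"
  unfolding petersen_out_def petersen_arcs_def by auto

lemma petersen_in_simps:
  "petersen_in 0 = {}" "petersen_in 1 = {0}" "petersen_in 2 = {1}" "petersen_in 3 = {2}"
  "petersen_in 4 = {0, 3}" "petersen_in 5 = {0}" "petersen_in 6 = {1}" "petersen_in 7 = {2, 5}"
  "petersen_in 8 = {3, 5, 6}" "petersen_in 9 = {4, 6, 7}"
  unfolding petersen_in_def petersen_arcs_def by auto

lemma atLeastAtMost_0_9: "{0..9} = {0, 1, 2, 3, 4, 5, 6, 7, 8, 9 :: nat}"
  by auto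

lemma petersen_neighbours_subset: "petersen_out x \<subseteq> {0..9}" "petersen_in x \<subseteq> {0..9}"
  unfolding petersen_out_def petersen_in_def petersen_arcs_def by auto

lemma finite_petersen_neighbours [simp]: "finite (petersen_out x)" "finite (petersen_in x)"
  by (rule finite_subset[OF petersen_neighbours_subset(1)], simp)
    (rule finite_subset[OF petersen_neighbours_subset(2)], simp)

lemma petersen_arcs_less: "(x, y) \<in> petersen_arcs \<Longrightarrow> x < y"
  unfolding petersen_arcs_def by auto

lemma petersen_out_in_disjoint: "petersen_out x \<inter> petersen_in x = {}"
  unfolding petersen_out_def petersen_in_def by (auto dest!: petersen_arcs_less)

lemma petersen_degree:
  assumes "x \<in> {0..9}"
  shows "card (petersen_out x) + card (petersen_in x) = 3"
  using assms unfolding atLeastAtMost_0_9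
  \<comment> \<open>Rewriting \<open>1\<close> to \<open>Suc 0\<close> would keep the table entries
    for vertex 1 from matching.\<close>
  by (elim insertE; simp add: petersen_out_simps petersen_in_simps del: One_nat_def)

section \<open>Neighbourhoods and degrees in the layered graph\<close>

definition cyc_pred :: "nat \<Rightarrow> nat \<Rightarrow> nat" where
  "cyc_pred n i = (if i = 1 then n else i - 1)"

lemma graph_G_neighbours:
  assumes "n \<ge> 2" "i \<in> {1..n}" "x \<in> {0..9}"
  shows "{v \<in> pverts (graph_G n). ((i, x), v) \<in> parcs (graph_G n)} =
    {i} \<times> (petersen_out x \<union> petersen_in x) \<union>
    ({cyc n i} \<times> petersen_out x \<union> {cyc_pred n i} \<times> petersen_in x)"
proof -
  have pred: "i = cyc n j \<longleftrightarrow> j = cyc_pred n i" if "j \<in> {1..n}" for j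
    using that assms by (auto simp: cyc_def cyc_pred_def)
  have "cyc n i \<in> {1..n}" "cyc_pred n i \<in> {1..n}"
    using assms by (auto simp: cyc_def cyc_pred_def)
  then show ?thesis
    using assms pred petersen_neighbours_subset[of x]
    by (auto simp: graph_G_def layer_arcs_def cross_arcs_def petersen_graph_def
        petersen_out_def petersen_in_def)
qed

text \<open>Stated for arbitrary commutative monoids to serve twice: with the constant 1 it counts
  neighbours, with an eigenfunction it expands the eigenvalue equation.\<close>

lemma sum_graph_G_neighbours:
  assumes "n \<ge> 2" "i \<in> {1..n}" "x \<in> {0..9}"
  shows "(\<Sum>v \<in> {v \<in> pverts (graph_G n). ((i, x), v) \<in> parcs (graph_G n)}. f v) =
    (\<Sum>y \<in> petersen_out x. f (i, y) + f (cyc n i, y)) +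
    (\<Sum>y \<in> petersen_in x. f (i, y) + (f (cyc_pred n i, y) :: 'a :: comm_monoid_add))"
proof -
  have ne: "cyc n i \<noteq> i" "cyc_pred n i \<noteq> i"
    using assms by (auto simp: cyc_def cyc_pred_def)
  have slice: "sum f ({j} \<times> B) = (\<Sum>y \<in> B. f (j, y))" for j :: nat and B :: "nat set"
  proof -
    have "{j} \<times> B = Pair j ` B"
      by auto
    then show ?thesis
      by (simp add: sum.reindex inj_on_def)
  qed
  \<comment> \<open>The layer of \<open>i\<close> differs from the two others by \<open>ne\<close>.
    Those two coincide for \<open>n = 2\<close>, so the cross parts are separated by their second
    components instead: out- and in-neighbours are disjoint.\<close>
  have "sum f ({i} \<times> (petersen_out x \<union> petersen_in x) \<union>
      ({cyc n i} \<times> petersen_out x \<union> {cyc_pred n i} \<times> petersen_in x)) =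
    sum f ({i} \<times> (petersen_out x \<union> petersen_in x)) +
    (sum f ({cyc n i} \<times> petersen_out x) + sum f ({cyc_pred n i} \<times> petersen_in x))"
    using ne petersen_out_in_disjoint[of x]
    by (subst sum.union_disjoint, auto)+
  also have "\<dots> = (\<Sum>y \<in> petersen_out x. f (i, y)) + (\<Sum>y \<in> petersen_in x. f (i, y)) +
    ((\<Sum>y \<in> petersen_out x. f (cyc n i, y)) + (\<Sum>y \<in> petersen_in x. f (cyc_pred n i, y)))"
    using petersen_out_in_disjoint[of x] by (simp add: slice sum.union_disjoint)
  finally show ?thesis
    using assms by (simp add: graph_G_neighbours sum.distrib ac_simps)
qed

text \<open>Each of the three Petersen edges at \<open>x\<close> yields one neighbour in the same
  layer and one in an adjacent layer.\<close>

lemma regular_graph_G: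
  assumes "n \<ge> 2"
  shows "regular_graph 6 (graph_G n)"
proof -
  have cyc: "cyc n i \<in> {1..n}" "cyc n i \<noteq> i" if "i \<in> {1..n}" for i
    using that assms by (auto simp: cyc_def)
  have arcs: "x \<in> {0..9}" "y \<in> {0..9}" "x \<noteq> y" if "(x, y) \<in> petersen_arcs" for x y
    using that by (auto simp: petersen_arcs_def)
  have pg: "pair_graph (graph_G n)"
  proof
    show "finite (pverts (graph_G n))"
      by (simp add: graph_G_def)
    show wf: "fst e \<in> pverts (graph_G n)" "snd e \<in> pverts (graph_G n)" "fst e \<noteq> snd e"
      if "e \<in> parcs (graph_G n)" for e
      using that cyc arcs
      by (fastforce simp: graph_G_def layer_arcs_def cross_arcs_def petersen_graph_def)+
    have "parcs (graph_G n) \<subseteq> pverts (graph_G n) \<times> pverts (graph_G n)"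
      using wf by (auto simp: mem_Times_iff)
    then show "finite (parcs (graph_G n))"
      by (rule finite_subset) (simp add: graph_G_def)
    show "symmetric (with_proj (graph_G n))"
      unfolding symmetric_def
      by (auto simp: sym_def graph_G_def layer_arcs_def cross_arcs_def petersen_graph_def)
  qed
  then interpret pair_graph "graph_G n" .
  have "out_degree (with_proj (graph_G n)) (i, x) = 6" if ix: "i \<in> {1..n}" "x \<in> {0..9}" for i x
  proof -
    let ?N = "{v \<in> pverts (graph_G n). ((i, x), v) \<in> parcs (graph_G n)}"
    have "out_arcs (with_proj (graph_G n)) (i, x) = Pair (i, x) ` ?N"
      using in_arcsD2 by (auto simp: out_arcs_def)
    then have "out_degree (with_proj (graph_G n)) (i, x) = card ?N"
      by (simp add: out_degree_def card_image inj_on_def)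
    also have "\<dots> = 2 * (card (petersen_out x) + card (petersen_in x))"
      using sum_graph_G_neighbours[OF assms ix, of "\<lambda>_. 1 :: nat"] by simp
    finally show ?thesis
      using petersen_degree[OF ix(2)] by simp
  qed
  then show ?thesis
    using pg by (auto simp: regular_graph_def graph_G_def)
qed

section \<open>Fourier transform over the layers\<close>

lemma bij_betw_cyc: "n \<ge> 2 \<Longrightarrow> bij_betw (cyc n) {1..n} {1..n}"
  by (rule bij_betw_byWitness[where f' = "cyc_pred n"]) (auto simp: cyc_def cyc_pred_def)

lemma cyc_pred_cyc: "i \<in> {1..n} \<Longrightarrow> cyc_pred n (cyc n i) = i"
  by (auto simp: cyc_def cyc_pred_def)

text \<open>At the wrap-around the exponent drops from \<open>n\<close> to 1, which
  \<open>w ^ n = 1\<close> makes consistent.\<close>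

lemma power_cyc:
  fixes w :: complex
  assumes "w ^ n = 1" "i \<in> {1..n}"
  shows "w ^ cyc n i = w * w ^ i"
  using assms by (cases "i = n") (auto simp: cyc_def)

text \<open>Injectivity of the discrete Fourier transform: a nonzero polynomial of degree below
  \<open>n\<close> cannot vanish at all \<open>n\<close> roots of unity.\<close>

lemma polynomial_zero_at_roots_of_unity:
  fixes a :: "nat \<Rightarrow> complex"
  assumes "n > 0" and zero: "\<And>w. w ^ n = 1 \<Longrightarrow> (\<Sum>i = 1..n. a i * w ^ i) = 0" and "i \<in> {1..n}"
  shows "a i = 0"
proof -
  \<comment> \<open>Indices are lowered by one so that the degree stays below \<open>n\<close>; the
    missing factor \<open>w\<close> is nonzero and cancels.\<close>
  define p where "p = (\<Sum>k<n. monom (a (Suc k)) k)"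
  have coeff_p: "coeff p k = (if k < n then a (Suc k) else 0)" for k
    by (simp add: p_def coeff_sum)
  have "p = 0"
  proof (rule ccontr)
    assume "p \<noteq> 0"
    have "poly p w = 0" if w: "w ^ n = 1" for w
    proof -
      have "w * poly p w = (\<Sum>k<n. a (Suc k) * w ^ Suc k)"
        by (simp add: p_def poly_sum poly_monom sum_distrib_left ac_simps)
      also have "\<dots> = (\<Sum>i = 1..n. a i * w ^ i)"
        by (simp add: sum.atLeast1_atMost_eq)
      finally have "w * poly p w = 0"
        using zero[OF w] by simp
      moreover have "w \<noteq> 0"
        using w \<open>n > 0\<close> by (auto simp: power_0_left)
      ultimately show ?thesis
        by simp
    qed
    then have "card {w :: complex. w ^ n = 1} \<le> card {w. poly p w = 0}"
      using \<open>p \<noteq> 0\<close> by (intro card_mono poly_roots_finite) auto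
    also have "\<dots> \<le> degree p"
      using \<open>p \<noteq> 0\<close> by (rule card_poly_roots_bound)
    also have "\<dots> < n"
      using \<open>n > 0\<close> \<open>p \<noteq> 0\<close> coeff_p by (metis leading_coeff_0_iff)
    finally show False
      using card_roots_unity_eq[OF \<open>n > 0\<close>] by simp
  qed
  then show ?thesis
    using coeff_p[of "i - 1"] assms(3) by (auto split: if_splits)
qed

lemma graph_G_eigenvalue_fourier:
  assumes "adjacency_eigenvalue (graph_G n) \<mu>" "n \<ge> 2"
  obtains w g where "w ^ n = 1" "\<exists>x \<in> {0..9}. g x \<noteq> 0"
    and "\<And>x. x \<in> {0..9} \<Longrightarrow> \<mu> * g x =
      (1 + 1 / w) * (\<Sum>y \<in> petersen_out x. g y) + (1 + w) * (\<Sum>y \<in> petersen_in x. g y)"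
proof -
  obtain f where nonzero: "\<exists>u \<in> pverts (graph_G n). f u \<noteq> 0"
    and eigen: "\<And>u. u \<in> pverts (graph_G n) \<Longrightarrow>
      \<mu> * f u = (\<Sum>v \<in> {v \<in> pverts (graph_G n). (u, v) \<in> parcs (graph_G n)}. f v)"
    using adjacency_eigenvalueE[OF assms(1)] by blast
  define g where "g w x = (\<Sum>i = 1..n. f (i, x) * w ^ i)" for w x
  obtain i x where ix: "i \<in> {1..n}" "x \<in> {0..9}" "f (i, x) \<noteq> 0"
    using nonzero by (auto simp: graph_G_def)
  \<comment> \<open>If the transform at this \<open>x\<close> vanished for every root of unity,
    \<open>f (i, x)\<close> would be 0 by injectivity.\<close>
  then obtain w where w: "w ^ n = 1" "g w x \<noteq> 0"
    using polynomial_zero_at_roots_of_unity[of n "\<lambda>i. f (i, x)" i] assms(2)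
    unfolding g_def by fastforce
  have "w \<noteq> 0"
    using w(1) assms(2) by (auto simp: power_0_left)
  have out_shift: "(\<Sum>i = 1..n. f (cyc n i, y) * w ^ i) = 1 / w * g w y" for y
  proof -
    \<comment> \<open>The extra factor \<open>w\<close> raises the exponent to
      \<open>cyc n i\<close>, so that the sum can be reindexed along the rotation.\<close>
    have "w * (\<Sum>i = 1..n. f (cyc n i, y) * w ^ i) =
        (\<Sum>i = 1..n. f (cyc n i, y) * w ^ cyc n i)"
      by (simp add: sum_distrib_left power_cyc[OF w(1)] ac_simps)
    also have "\<dots> = g w y"
      unfolding g_def by (rule sum.reindex_bij_betw[OF bij_betw_cyc[OF assms(2)]])
    finally show ?thesis
      using \<open>w \<noteq> 0\<close> by (simp add: field_simps)
  qed
  have in_shift: "(\<Sum>i = 1..n. f (cyc_pred n i, y) * w ^ i) = w * g w y" for y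
  proof -
    have "(\<Sum>i = 1..n. f (cyc_pred n i, y) * w ^ i) =
        (\<Sum>i = 1..n. f (cyc_pred n (cyc n i), y) * w ^ cyc n i)"
      by (rule sum.reindex_bij_betw[OF bij_betw_cyc[OF assms(2)], symmetric])
    also have "\<dots> = w * g w y"
      by (simp add: g_def sum_distrib_left cyc_pred_cyc power_cyc[OF w(1)] ac_simps)
    finally show ?thesis .
  qed
  have "\<mu> * g w x =
      (1 + 1 / w) * (\<Sum>y \<in> petersen_out x. g w y) + (1 + w) * (\<Sum>y \<in> petersen_in x. g w y)"
    if x: "x \<in> {0..9}" for x
  proof -
    have local_eigen: "\<mu> * f (i, x) = (\<Sum>y \<in> petersen_out x. f (i, y) + f (cyc n i, y)) +
        (\<Sum>y \<in> petersen_in x. f (i, y) + f (cyc_pred n i, y))" if i: "i \<in> {1..n}" for i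
    proof -
      have "(i, x) \<in> pverts (graph_G n)"
        using i x by (simp add: graph_G_def)
      then show ?thesis
        unfolding sum_graph_G_neighbours[OF assms(2) i x, symmetric] by (rule eigen)
    qed
    have "\<mu> * g w x = (\<Sum>i = 1..n. \<mu> * f (i, x) * w ^ i)"
      by (simp add: g_def sum_distrib_left ac_simps)
    also have "\<dots> = (\<Sum>i = 1..n.
        ((\<Sum>y \<in> petersen_out x. f (i, y) + f (cyc n i, y)) +
         (\<Sum>y \<in> petersen_in x. f (i, y) + f (cyc_pred n i, y))) * w ^ i)"
      by (intro sum.cong refl) (simp only: local_eigen)
    also have "\<dots> =
        (\<Sum>y \<in> petersen_out x. \<Sum>i = 1..n. f (i, y) * w ^ i + f (cyc n i, y) * w ^ i) +
        (\<Sum>y \<in> petersen_in x. \<Sum>i = 1..n. f (i, y) * w ^ i + f (cyc_pred n i, y) * w ^ i)"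
      by (simp only: sum.swap[of _ "{1..n}"] sum.distrib[symmetric] sum_distrib_right distrib_right)
    also have "\<dots> = (\<Sum>y \<in> petersen_out x. g w y + 1 / w * g w y) +
        (\<Sum>y \<in> petersen_in x. g w y + w * g w y)"
      unfolding sum.distrib[where A = "{1..n}"] out_shift in_shift by (simp add: g_def)
    finally show ?thesis
      by (simp add: sum.distrib sum_distrib_left algebra_simps)
  qed
  with w ix(2) show thesis
    by (intro that[of w "g w"]) auto
qed

section \<open>Eigenvalues of the operators on the Petersen graph\<close>

text \<open>Row-sum estimate: at a vertex where \<open>cmod (g x)\<close> is maximal, the three
  neighbours contribute at most \<open>r\<close> times this maximum each.\<close>

lemma weighted_petersen_eigenvalue_bound:
  fixes g :: "nat \<Rightarrow> complex"
  assumes "cmod a \<le> r" "cmod b \<le> r" and "\<exists>x \<in> {0..9}. g x \<noteq> 0"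
    and eigen: "\<And>x. x \<in> {0..9} \<Longrightarrow>
      \<mu> * g x = a * (\<Sum>y \<in> petersen_out x. g y) + b * (\<Sum>y \<in> petersen_in x. g y)"
  shows "cmod \<mu> \<le> 3 * r"
proof -
  define M where "M = Max ((\<lambda>x. cmod (g x)) ` {0..9})"
  have M: "cmod (g x) \<le> M" if "x \<in> {0..9}" for x
    using that by (simp add: M_def)
  have "M \<in> (\<lambda>x. cmod (g x)) ` {0..9}"
    unfolding M_def by (rule Max_in) auto
  then obtain x where x: "x \<in> {0..9}" "M = cmod (g x)"
    by blast
  have "M > 0"
    using assms(3) M by (metis less_le_trans zero_less_norm_iff)
  have "0 \<le> r"
    using assms(1) norm_ge_zero order_trans by blast
  have sums: "cmod (\<Sum>y \<in> B. g y) \<le> of_nat (card B) * M" if "B \<subseteq> {0..9}" for B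
    using that M by (intro sum_norm_bound) auto
  have "cmod \<mu> * M = cmod (\<mu> * g x)"
    by (simp add: x norm_mult)
  also have "\<dots> \<le> cmod a * cmod (\<Sum>y \<in> petersen_out x. g y) +
      cmod b * cmod (\<Sum>y \<in> petersen_in x. g y)"
    unfolding eigen[OF x(1)] by (metis norm_mult norm_triangle_ineq)
  also have "\<dots> \<le> r * (card (petersen_out x) * M) + r * (card (petersen_in x) * M)"
    using assms(1,2) \<open>0 \<le> r\<close> sums petersen_neighbours_subset
    by (intro add_mono mult_mono) auto
  also have "\<dots> = r * real (card (petersen_out x) + card (petersen_in x)) * M"
    by (simp add: algebra_simps)
  finally show ?thesis
    using \<open>M > 0\<close> petersen_degree[OF x(1)] by simp
qed

text \<open>Summing the equations over all vertices of this 3-regular graph gives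
  \<open>\<mu> * T = 3 * T\<close>. So either \<open>\<mu> = 3\<close> or \<open>T = 0\<close>, and
  in the second case the quadratic relation annihilates a nonzero \<open>g\<close>.\<close>

lemma petersen_eigenvalue:
  fixes g :: "nat \<Rightarrow> complex"
  assumes nonzero: "\<exists>x \<in> {0..9}. g x \<noteq> 0"
    and eigen: "\<And>x. x \<in> {0..9} \<Longrightarrow>
      \<mu> * g x = (\<Sum>y \<in> petersen_out x. g y) + (\<Sum>y \<in> petersen_in x. g y)"
  shows "\<mu> \<in> {3, 1, - 2}"
proof -
  define T where "T = (\<Sum>x \<in> {0..9}. g x)"
  have T: "T = g 0 + g 1 + g 2 + g 3 + g 4 + g 5 + g 6 + g 7 + g 8 + g 9"
    unfolding T_def atLeastAtMost_0_9 by simp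
  have e:
    "\<mu> * g 0 = g 1 + g 4 + g 5" "\<mu> * g 1 = g 0 + g 2 + g 6" "\<mu> * g 2 = g 1 + g 3 + g 7"
    "\<mu> * g 3 = g 2 + g 4 + g 8" "\<mu> * g 4 = g 0 + g 3 + g 9" "\<mu> * g 5 = g 0 + g 7 + g 8"
    "\<mu> * g 6 = g 1 + g 8 + g 9" "\<mu> * g 7 = g 2 + g 5 + g 9" "\<mu> * g 8 = g 3 + g 5 + g 6"
    "\<mu> * g 9 = g 4 + g 6 + g 7"
    using eigen[of 0] eigen[of 1] eigen[of 2] eigen[of 3] eigen[of 4]
      eigen[of 5] eigen[of 6] eigen[of 7] eigen[of 8] eigen[of 9]
    by (simp_all add: petersen_out_simps petersen_in_simps ac_simps del: One_nat_def)
  have "\<mu> * T = 3 * T"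
    unfolding T by (simp add: distrib_left e del: One_nat_def)
  then have "T = 0" if "\<mu> \<noteq> 3"
    using that by simp
  \<comment> \<open>The Petersen graph is strongly regular: \<open>A\<^sup>2 + A - 2 * I\<close> is the all-ones matrix.\<close>
  moreover have "(\<mu> - 1) * (\<mu> + 2) * g x = T" if "x \<in> {0..9}" for x
  proof -
    have "(\<mu> - 1) * (\<mu> + 2) * g x = \<mu> * (\<mu> * g x) + \<mu> * g x - 2 * g x"
      by (simp add: algebra_simps)
    also have "\<dots> = T"
      using that unfolding atLeastAtMost_0_9 T
      by (elim insertE; simp add: distrib_left e del: One_nat_def)
    finally show ?thesis .
  qed
  ultimately have "\<mu> = 3 \<or> (\<mu> - 1) * (\<mu> + 2) = 0"
    using nonzero by (metis mult_eq_0_iff)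
  then show ?thesis
    by (auto simp: eq_neg_iff_add_eq_0)
qed

text \<open>Holds for every \<open>n \<ge> 2\<close>; the values 3 and 4 matter only for the size of
  \<open>cmod (1 + w)\<close>.\<close>

lemma graph_G_eigenvalue_cases:
  assumes "adjacency_eigenvalue (graph_G n) \<mu>" "n \<ge> 2"
  shows "\<mu> \<in> {6, 2, - 4} \<or> (\<exists>w. w ^ n = 1 \<and> w \<noteq> 1 \<and> cmod \<mu> \<le> 3 * cmod (1 + w))"
proof -
  obtain w g where w: "w ^ n = 1" and nonzero: "\<exists>x \<in> {0..9}. g x \<noteq> 0"
    and eigen: "\<And>x. x \<in> {0..9} \<Longrightarrow> \<mu> * g x =
      (1 + 1 / w) * (\<Sum>y \<in> petersen_out x. g y) + (1 + w) * (\<Sum>y \<in> petersen_in x. g y)"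
    using graph_G_eigenvalue_fourier[OF assms] by blast
  show ?thesis
  proof (cases "w = 1")
    case True
    \<comment> \<open>Both weights equal 2 here, so halving leaves the plain Petersen
      operator.\<close>
    have "\<mu> / 2 \<in> {3, 1, - 2}"
    proof (rule petersen_eigenvalue[OF nonzero])
      show "\<mu> / 2 * g x = (\<Sum>y \<in> petersen_out x. g y) + (\<Sum>y \<in> petersen_in x. g y)"
        if "x \<in> {0..9}" for x
        using eigen[OF that] True by simp
    qed
    then show ?thesis
      by (auto simp: field_simps)
  next
    case False
    have "w \<noteq> 0"
      using w assms(2) by (auto simp: power_0_left)
    have "cmod w = 1"
      using w assms(2) by (metis not_numeral_le_zero power_eq_1_iff)
    have "1 + 1 / w = (1 + w) / w"
      using \<open>w \<noteq> 0\<close> by (simp add: field_simps)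
    then have "cmod (1 + 1 / w) \<le> cmod (1 + w)"
      using \<open>cmod w = 1\<close> by (simp add: norm_divide)
    then have "cmod \<mu> \<le> 3 * cmod (1 + w)"
      by (rule weighted_petersen_eigenvalue_bound[OF _ order_refl nonzero eigen])
    then show ?thesis
      using w False by blast
  qed
qed

section \<open>Numerical bounds for three and four layers\<close>

text \<open>For a nontrivial cube root of unity \<open>1 + w = - (w\<^sup>2)\<close> has modulus 1.
  For fourth roots \<open>w\<close> is \<open>- 1\<close>, \<open>\<i>\<close> or
  \<open>- \<i>\<close>, giving modulus 0 or \<open>sqrt 2\<close>.\<close>

lemma cmod_one_plus_root_of_unity_3_4:
  assumes "n \<in> {3, 4}" "w ^ n = 1" "w \<noteq> 1"
  shows "cmod (1 + w) \<le> sqrt 2"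
proof (cases "n = 3")
  case True
  then have w3: "w ^ 3 = 1"
    using assms by simp
  then have "(w - 1) * (w\<^sup>2 + w + 1) = 0"
    by (simp add: algebra_simps power2_eq_square power3_eq_cube)
  then have "1 + w = - (w\<^sup>2)"
    using assms(3) by (simp add: eq_neg_iff_add_eq_0 ac_simps)
  moreover have "cmod w = 1"
    using w3 by (metis power_eq_1_iff zero_neq_numeral)
  ultimately show ?thesis
    by (simp add: norm_power)
next
  case False
  then have "w ^ 4 = 1"
    using assms by simp
  then have "(w - 1) * (w + 1) * ((w - \<i>) * (w + \<i>)) = 0"
    by (simp add: algebra_simps power4_eq_xxxx)
  then have "w = - 1 \<or> w = \<i> \<or> w = - \<i>"
    using assms(3) by (auto simp: eq_neg_iff_add_eq_0)
  then show ?thesis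
    by (auto simp: cmod_def)
qed

lemma graph_G_eigenvalue_bound:
  assumes "n \<in> {3, 4}" "adjacency_eigenvalue (graph_G n) \<mu>" "\<mu> \<noteq> 6"
  shows "cmod \<mu> \<le> 2 * sqrt 5"
proof -
  \<comment> \<open>Needed for the eigenvalue \<open>- 4\<close> from the trivial root
    \<open>w = 1\<close>.\<close>
  have four: "4 \<le> 2 * sqrt 5"
    using real_le_rsqrt[of 2 5] by simp
  have "n \<ge> 2"
    using assms(1) by auto
  from graph_G_eigenvalue_cases[OF assms(2) this]
  consider "\<mu> \<in> {2, - 4}" | w where "w ^ n = 1" "w \<noteq> 1" "cmod \<mu> \<le> 3 * cmod (1 + w)"
    using assms(3) by blast
  then show ?thesis
  proof cases
    case 1
    then show ?thesis
      using four by auto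
  next
    case 2
    then have "cmod \<mu> \<le> 3 * sqrt 2"
      using cmod_one_plus_root_of_unity_3_4[OF assms(1)] by fastforce
    also have "\<dots> \<le> 2 * sqrt 5"
      \<comment> \<open>Comparison of squares: 18 against 20.\<close>
      by (rule power2_le_imp_le) (simp_all add: power_mult_distrib)
    finally show ?thesis .
  qed
qed

theorem theorem5p1:
  shows "\<forall>n \<in> {3, 4}.
    ramanujan_graph 6 (graph_G n) \<and>
    (\<forall>\<mu>. adjacency_eigenvalue (graph_G n) \<mu> \<and> \<mu> \<noteq> 6 \<and> \<mu> \<noteq> - 6 \<longrightarrow> cmod \<mu> \<le> 2 * sqrt 5)"
  \<comment> \<open>With \<open>d = 6\<close> the radicand \<open>real d - 1\<close> is 5, so one
    bound yields both conjuncts.\<close>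
  using regular_graph_G graph_G_eigenvalue_bound by (auto simp: ramanujan_graph_def)

end
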